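(* Let $\mathbb{F}_q$ be a finite field, let $H$ be a subgroup of $\mathbb{F}_q^\times$, let $\chi\colon H\to\mathbb{C}^\times$ be a character, and suppose that $(\mathbb{F}_q,\chi)$ has the strong uncertainty property. (i) If $\chi$ is nontrivial, then for any $H$-closed subsets $A$ and $B$ of $\mathbb{F}_q^\times$ with $|A|+|B|\geq q+|H|-1$, there is a $\chi$-symmetric $f\in\mathbb{C}[\mathbb{F}_q]$ with $\operatorname{supp}(f)=A$ and $\operatorname{supp}(\widehat f)=\epsilon_B$. (ii) If $\chi$ is trivial and $A$ and $B$ are $H$-closed subsets of $\mathbb{F}_q$ with $$|A|+|B|\geq\begin{cases}q+2|H|-1 & \text{if $0$ is in neither $A$ nor $B$},\\ q+|H| & \text{if $0$ is in precisely one of $A$ or $B$},\\ q+1 & \text{if $0$ is in both $A$ and $B$},\end{cases}$$ then there is a $\chi$-symmetric $f\in\mathbb{C}[\mathbb{F}_q]$ with $\operatorname{supp}(f)=A$ and $\operatorname{supp}(\widehat f)=\epsilon_B$.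
   Context: $\mathbb{F}_q$ is the finite field of order $q$ and characteristic $p$, with absolute trace $\operatorname{Tr}\colon\mathbb{F}_q\to\mathbb{F}_p$. Let $\epsilon(x)=\exp(2\pi i\operatorname{Tr}(x)/p)$ and, for $a\in\mathbb{F}_q$, $\epsilon_a(x)=\epsilon(ax)$. Then $\widehat{\mathbb{F}}_q=\{\epsilon_a:a\in\mathbb{F}_q\}$ is the group of all additive characters $\mathbb{F}_q\to\mathbb{C}^\times$ ($\epsilon_0$ is trivial). For $S\subseteq\mathbb{F}_q$, $\epsilon_S=\{\epsilon_s:s\in S\}$. $\mathbb{C}[\mathbb{F}_q]$ is the group ring of the additive group; its elements $f=\sum_{a\in\mathbb{F}_q}f_a[a]$ are identified with functions $a\mapsto f(a)=f_a$, and $\operatorname{supp}(f)=\{a:f_a\ne0\}$. The Fourier transform of $f$ is the function $\widehat f\colon\widehat{\mathbb{F}}_q\to\mathbb{C}$, $\widehat f(\psi)=\sum_a f_a\psi(a)$, with support $\{\psi:\widehat f(\psi)\neq0\}$. $H$ acts on $\mathbb{F}_q$ by multiplication; a subset is $H$-closed if it is a union of $H$-orbits. A character of $H$ is a group homomorphism $\chi\colon H\to\mathbb{C}^\times$ (trivial if identically $1$). An element $f\in\mathbb{C}[\mathbb{F}_q]$ is $\chi$-symmetric if $f_{ha}=\chi(h)f_a$ for all $h\in H$, $a\in\mathbb{F}_q$. $(\mathbb{F}_q,\chi)$ has the strong uncertainty property if every nonzero $\chi$-symmetric $f\in\mathbb{C}[\mathbb{F}_q]$ satisfies: if $\chi$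 is nontrivial, $|\operatorname{supp}(f)|+|\operatorname{supp}(\widehat f)|\ge q+|H|-1$; if $\chi$ is trivial, $|\operatorname{supp}(f)|+|\operatorname{supp}(\widehat f)|$ is at least $q+2|H|-1$ if $f(0)=0$ and $\widehat f(\epsilon_0)=0$, at least $q+|H|$ if exactly one of $f(0)$, $\widehat f(\epsilon_0)$ is $0$, and at least $q+1$ otherwise. *)

theory Defs
  imports Complex_Main "HOL-Library.Cardinality" "HOL-Computational_Algebra.Primes"
begin

text \<open>
  The field with \<open>q\<close> elements is a type \<open>'a :: finite_field\<close>, so \<open>q = CARD('a)\<close> and
  \<open>p = CHAR('a)\<close>.
\<close>

definition field_degree :: "'a :: finite_field itself \<Rightarrow> nat" where
  "field_degree _ = (THE n. CARD('a) = CHAR('a) ^ n)"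

definition abs_trace :: "'a :: finite_field \<Rightarrow> 'a" where
  "abs_trace x = (\<Sum>i<field_degree TYPE('a). x ^ (CHAR('a) ^ i))"

text \<open>
  \<open>abs_trace x\<close> lies in the prime subfield, whose elements are the residues of \<open>0, \<dots>, p - 1\<close>;
  the exponential is evaluated at that representative.
\<close>

definition abs_trace_nat :: "'a :: finite_field \<Rightarrow> nat" where
  "abs_trace_nat x = (THE k. k < CHAR('a) \<and> of_nat k = abs_trace x)"

definition eps1 :: "'a :: finite_field \<Rightarrow> complex" where
  "eps1 x = exp (2 * of_real pi * \<i> * of_nat (abs_trace_nat x) / of_nat CHAR('a))"

definition eps :: "'a :: finite_field \<Rightarrow> 'a \<Rightarrow> complex" where
  "eps a = (\<lambda>x. eps1 (a * x))"

definition dual_group :: "('a :: finite_field \<Rightarrow> complex) set" where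
  "dual_group = range eps"

text \<open>
  Elements of the complex group ring of the additive group are represented by their coefficient
  functions \<open>'a \<Rightarrow> complex\<close>. The Fourier transform takes the character itself as argument; only its
  values on \<open>dual_group\<close> are meaningful.
\<close>

definition supp :: "('a :: finite_field \<Rightarrow> complex) \<Rightarrow> 'a set" where
  "supp f = {a. f a \<noteq> 0}"

definition fourier :: "('a :: finite_field \<Rightarrow> complex) \<Rightarrow> ('a \<Rightarrow> complex) \<Rightarrow> complex" where
  "fourier f \<psi> = (\<Sum>a\<in>UNIV. f a * \<psi> a)"

definition fourier_supp :: "('a :: finite_field \<Rightarrow> complex) \<Rightarrow> ('a \<Rightarrow> complex) set" where
  "fourier_supp f = {\<psi> \<in> dual_group. fourier f \<psi> \<noteq> 0}"

definition mult_subgroup :: "'a :: finite_field set \<Rightarrow> bool" where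
  "mult_subgroup H \<longleftrightarrow>
     H \<subseteq> UNIV - {0} \<and> 1 \<in> H \<and> (\<forall>g\<in>H. \<forall>h\<in>H. g * h \<in> H) \<and> (\<forall>h\<in>H. inverse h \<in> H)"

definition orbit :: "'a :: finite_field set \<Rightarrow> 'a \<Rightarrow> 'a set" where
  "orbit H a = (\<lambda>h. h * a) ` H"

definition H_closed :: "'a :: finite_field set \<Rightarrow> 'a set \<Rightarrow> bool" where
  "H_closed H S \<longleftrightarrow> (\<exists>T. S = (\<Union>a\<in>T. orbit H a))"

text \<open>Characters of \<open>H\<close> are total functions of which only the values on \<open>H\<close> matter.\<close>

definition mult_character :: "'a :: finite_field set \<Rightarrow> ('a \<Rightarrow> complex) \<Rightarrow> bool" where
  "mult_character H \<chi> \<longleftrightarrow>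
     (\<forall>h\<in>H. \<chi> h \<noteq> 0) \<and> (\<forall>g\<in>H. \<forall>h\<in>H. \<chi> (g * h) = \<chi> g * \<chi> h)"

definition trivial_character :: "'a :: finite_field set \<Rightarrow> ('a \<Rightarrow> complex) \<Rightarrow> bool" where
  "trivial_character H \<chi> \<longleftrightarrow> (\<forall>h\<in>H. \<chi> h = 1)"

definition chi_symmetric ::
  "'a :: finite_field set \<Rightarrow> ('a \<Rightarrow> complex) \<Rightarrow> ('a \<Rightarrow> complex) \<Rightarrow> bool" where
  "chi_symmetric H \<chi> f \<longleftrightarrow> (\<forall>h\<in>H. \<forall>a. f (h * a) = \<chi> h * f a)"

text \<open>
  The subtractions are on natural numbers but never truncate, as \<open>card H \<ge> 1\<close> for a subgroup.
\<close>

definition strong_uncertainty :: "'a :: finite_field set \<Rightarrow> ('a \<Rightarrow> complex) \<Rightarrow> bool" where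
  "strong_uncertainty H \<chi> \<longleftrightarrow>
     (\<forall>f. f \<noteq> (\<lambda>_. 0) \<and> chi_symmetric H \<chi> f \<longrightarrow>
       (\<not> trivial_character H \<chi> \<longrightarrow>
          card (supp f) + card (fourier_supp f) \<ge> CARD('a) + card H - 1) \<and>
       (trivial_character H \<chi> \<longrightarrow>
          card (supp f) + card (fourier_supp f) \<ge>
            (if f 0 = 0 \<and> fourier f (eps 0) = 0 then CARD('a) + 2 * card H - 1
             else if f 0 = 0 \<or> fourier f (eps 0) = 0 then CARD('a) + card H
             else CARD('a) + 1)))"

end

theory Submission
  imports Defs
begin

text \<open>
  Count orbits instead of points, leaving out the orbit \<open>{0}\<close> when \<open>\<chi>\<close> is nontrivial, and let \<open>N\<close>
  be the number of orbits counted. In every case, the strong uncertainty property says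
  that the supports of \<open>f \<noteq> 0\<close> and of its transform have together at least \<open>N + 1\<close> orbits, and the
  hypothesis on \<open>A\<close> and \<open>B\<close> says that these have together at least \<open>N + 1\<close> orbits. If \<open>A\<close> and \<open>B\<close>
  have exactly \<open>N + 1\<close> orbits, then a dimension count gives a nonzero \<open>f\<close> supported in \<open>A\<close> whose
  transform is supported in \<open>B\<close>, and by uncertainty both supports are everything allowed. In general,
  every orbit of \<open>A\<close> or \<open>B\<close> belongs to such a tight subconfiguration, and a generic linear combination
  of the functions obtained has full supports.
\<close>

section \<open>Linear systems, generic combinations and subset sizes\<close>

lemma underdetermined_system:
  fixes M :: "'j \<Rightarrow> 'i \<Rightarrow> 'b :: field"
  assumes "finite J" "finite I" "card J < card I"
  shows "\<exists>x. (\<exists>i\<in>I. x i \<noteq> 0) \<and> (\<forall>j\<in>J. (\<Sum>i\<in>I. M j i * x i) = 0)"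
  using assms
proof (induction J arbitrary: I M rule: finite_induct)
  case empty
  then have "I \<noteq> {}" by auto
  then show ?case by (intro exI[of _ "\<lambda>_. 1"]) auto
next
  case (insert j J)
  show ?case
  proof (cases "\<forall>i\<in>I. M j i = 0")
    case True
    have "card J < card I" using insert.prems insert.hyps by simp
    from insert.IH[OF insert.prems(1) this, of M] True show ?thesis by auto
  next
    case False
    then obtain i0 where i0: "i0 \<in> I" "M j i0 \<noteq> 0" by auto
    let ?I = "I - {i0}"
    have "card J < card ?I" using insert.prems insert.hyps i0 by simp
    \<comment> \<open>Gaussian elimination: row \<open>j\<close>, whose entry at the pivot
      \<open>i0\<close> is nonzero, clears column \<open>i0\<close> in every other row.\<close>
    from insert.IH[OF _ this, of "\<lambda>k i. M k i - M k i0 * M j i / M j i0"] insert.prems(1)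
    obtain x where x: "\<exists>i\<in>?I. x i \<noteq> 0"
      "\<And>k. k \<in> J \<Longrightarrow> (\<Sum>i\<in>?I. (M k i - M k i0 * M j i / M j i0) * x i) = 0"
      by auto
    define s where "s = (\<Sum>i\<in>?I. M j i * x i)"
    \<comment> \<open>The pivot unknown gets the value that solves equation
      \<open>j\<close>.\<close>
    define y where "y = x(i0 := - s / M j i0)"
    have split: "(\<Sum>i\<in>I. M k i * y i) = M k i0 * (- s / M j i0) + (\<Sum>i\<in>?I. M k i * x i)" for k
    proof -
      have "(\<Sum>i\<in>?I. M k i * y i) = (\<Sum>i\<in>?I. M k i * x i)"
        by (rule sum.cong) (auto simp: y_def)
      then show ?thesis
        using sum.remove[OF insert.prems(1) i0(1), of "\<lambda>i. M k i * y i"] by (simp add: y_def)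
    qed
    have "(\<Sum>i\<in>I. M j i * y i) = 0"
      using i0 by (simp add: split s_def[symmetric])
    moreover have "(\<Sum>i\<in>I. M k i * y i) = 0" if "k \<in> J" for k
    proof -
      have "0 = (\<Sum>i\<in>?I. M k i * x i - (M k i0 / M j i0) * (M j i * x i))"
        using x(2)[OF that] by (simp add: algebra_simps)
      also have "\<dots> = (\<Sum>i\<in>?I. M k i * x i) - (M k i0 / M j i0) * s"
        by (simp only: sum_subtractf sum_distrib_left s_def)
      finally show ?thesis by (simp add: split)
    qed
    moreover have "\<exists>i\<in>I. y i \<noteq> 0" using x(1) by (auto simp: y_def)
    ultimately show ?thesis by blast
  qed
qed

text \<open>Induction on \<open>S\<close>: if \<open>f\<close> is nonzero on \<open>S\<close> and
  \<open>g\<close> at the new point, each point rules out at most one scalar \<open>t\<close> for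
  \<open>f + t * g\<close>, and an infinite field has others left.\<close>

lemma common_nonvanishing_element:
  fixes W :: "('s \<Rightarrow> 'b :: field_char_0) set"
  assumes "finite S" "W \<noteq> {}"
    and comb: "\<And>f g t. f \<in> W \<Longrightarrow> g \<in> W \<Longrightarrow> (\<lambda>s. f s + t * g s) \<in> W"
    and "\<And>s. s \<in> S \<Longrightarrow> \<exists>f\<in>W. f s \<noteq> 0"
  shows "\<exists>f\<in>W. \<forall>s\<in>S. f s \<noteq> 0"
  using assms(1,4)
proof (induction S rule: finite_induct)
  case empty
  then show ?case using assms(2) by auto
next
  case (insert s S)
  then obtain f g where f: "f \<in> W" "\<forall>s\<in>S. f s \<noteq> 0" and g: "g \<in> W" "g s \<noteq> 0"
    by (metis insertCI)
  \<comment> \<open>Where \<open>g r = 0\<close>, division by zero makes the excluded scalar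
    \<open>0\<close>; this is harmless, since \<open>f r\<close> is nonzero there.\<close>
  obtain t where t: "t \<notin> (\<lambda>r. - f r / g r) ` insert s S"
    using ex_new_if_finite[OF infinite_UNIV_char_0] insert.hyps(1)
    by (metis finite.insertI finite_imageI)
  have "f r + t * g r \<noteq> 0" if "r \<in> insert s S" for r
  proof (cases "g r = 0")
    case True
    then show ?thesis using that f g by auto
  next
    case False
    have "t \<noteq> - f r / g r" using t that by blast
    then show ?thesis using False
      by (metis add_eq_0_iff nonzero_eq_divide_eq)
  qed
  then show ?case using comb[OF f(1) g(1), of t] by (intro bexI[of _ "\<lambda>s. f s + t * g s"]) auto
qed

text \<open>Serves to pass from large supports to tight ones through a given orbit.\<close>

lemma subsets_with_card_sum:
  assumes "finite X" "finite Y" "a \<in> X" "Suc N \<le> card X + card Y"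
  shows "\<exists>K L. K \<subseteq> X \<and> L \<subseteq> Y \<and> a \<in> K \<and> card K + card L = Suc N"
proof -
  \<comment> \<open>\<open>L\<close> takes as many elements as it can, but at most \<open>N\<close>,
    so that at least one is left for \<open>K\<close> to contain \<open>a\<close>.\<close>
  define l where "l = min (card Y) N"
  obtain L where L: "L \<subseteq> Y" "card L = l"
    using obtain_subset_with_card_n[of l Y] by (auto simp: l_def)
  have "N - l \<le> card (X - {a})" using assms by (simp add: l_def)
  then obtain K where K: "K \<subseteq> X - {a}" "card K = N - l"
    using obtain_subset_with_card_n[of "N - l" "X - {a}"] by auto
  have "card (insert a K) = Suc (N - l)"
    using K assms(1) by (subst card_insert_disjoint) (auto intro: finite_subset)
  then have "card (insert a K) + card L = Suc N" using L by (simp add: l_def)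
  then show ?thesis using K L assms(3) by (intro exI[of _ "insert a K"] exI[of _ L]) auto
qed

section \<open>Symmetric functions, their supports and the action on the field\<close>

text \<open>Indexing characters by field elements turns the support of the transform into a subset
  of the field, on which \<open>H\<close> acts just as on \<open>supp f\<close>.\<close>

definition spectrum :: "('a :: finite_field \<Rightarrow> complex) \<Rightarrow> 'a set" where
  "spectrum f = {b. fourier f (eps b) \<noteq> 0}"

lemma fourier_supp_eq: "fourier_supp f = eps ` spectrum f"
  by (auto simp: fourier_supp_def spectrum_def dual_group_def)

lemma fourier_add_scaled:
  "fourier (\<lambda>y. f y + t * g y) \<psi> = fourier f \<psi> + t * fourier g \<psi>"
  by (simp add: fourier_def algebra_simps sum.distrib sum_distrib_left)

locale subgroup_character =
  fixes H :: "'a :: finite_field set" and \<chi> :: "'a \<Rightarrow> complex"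
  assumes subgroup: "mult_subgroup H" and character: "mult_character H \<chi>"
begin

lemma nonzero: "h \<in> H \<Longrightarrow> h \<noteq> 0"
  and one_mem: "1 \<in> H"
  and mult_mem: "g \<in> H \<Longrightarrow> h \<in> H \<Longrightarrow> g * h \<in> H"
  and inverse_mem: "h \<in> H \<Longrightarrow> inverse h \<in> H"
  using subgroup by (auto simp: mult_subgroup_def)

lemma chi_mult: "g \<in> H \<Longrightarrow> h \<in> H \<Longrightarrow> \<chi> (g * h) = \<chi> g * \<chi> h"
  and chi_nonzero: "h \<in> H \<Longrightarrow> \<chi> h \<noteq> 0"
  using character by (auto simp: mult_character_def)

lemma card_H_pos: "card H > 0"
  using one_mem by (auto simp: card_gt_0_iff)

lemma mem_orbit_self: "a \<in> orbit H a"
  using one_mem by (force simp: orbit_def)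

lemma orbit_eq: "b \<in> orbit H a \<Longrightarrow> orbit H b = orbit H a"
proof -
  assume "b \<in> orbit H a"
  then obtain g where g: "g \<in> H" "b = g * a" by (auto simp: orbit_def)
  have "h * a = (h * inverse g) * b" if "h \<in> H" for h
    using g nonzero[of g] by simp
  then have "orbit H a \<subseteq> orbit H b"
    unfolding orbit_def using g mult_mem inverse_mem by blast
  moreover have "orbit H b \<subseteq> orbit H a"
    using g mult_mem by (force simp: orbit_def mult.assoc[symmetric])
  ultimately show ?thesis by blast
qed

lemma card_orbit: "a \<noteq> 0 \<Longrightarrow> card (orbit H a) = card H"
  unfolding orbit_def by (rule card_image) (auto simp: inj_on_def)

text \<open>Invariance in place of unions of orbits: supports of symmetric functions satisfy it at
  once, as \<open>\<chi>\<close> does not vanish on \<open>H\<close>.\<close>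

definition closed :: "'a set \<Rightarrow> bool" where
  "closed S \<longleftrightarrow> (\<forall>h\<in>H. \<forall>y. h * y \<in> S \<longleftrightarrow> y \<in> S)"

lemma closed_iff: "closed S \<longleftrightarrow> (\<forall>y\<in>S. orbit H y \<subseteq> S)"
proof
  assume "closed S"
  then show "\<forall>y\<in>S. orbit H y \<subseteq> S" by (auto simp: closed_def orbit_def)
next
  assume S: "\<forall>y\<in>S. orbit H y \<subseteq> S"
  show "closed S" unfolding closed_def
  proof (intro ballI allI)
    fix h y assume h: "h \<in> H"
    then have "h * y \<in> orbit H y" by (auto simp: orbit_def)
    then show "h * y \<in> S \<longleftrightarrow> y \<in> S"
      using S orbit_eq mem_orbit_self by blast
  qed
qed

lemma H_closed_imp_closed: "H_closed H S \<Longrightarrow> closed S"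
  unfolding closed_iff H_closed_def using orbit_eq by blast

lemma closed_UNIV: "closed UNIV"
  by (simp add: closed_def)

text \<open>Where a symmetric function can be nonzero: \<open>H\<close> fixes \<open>0\<close>, so a
  nontrivial \<open>\<chi>\<close> forces the value \<open>0\<close> there. This lets both parts of
  the theorem be proved together.\<close>

definition active :: "'a set" where
  "active = (if trivial_character H \<chi> then UNIV else UNIV - {0})"

lemma symmetric_supp_active:
  assumes "chi_symmetric H \<chi> f"
  shows "supp f \<subseteq> active"
proof (cases "trivial_character H \<chi>")
  case False
  then obtain h where "h \<in> H" "\<chi> h \<noteq> 1" by (auto simp: trivial_character_def)
  moreover have "f (h * 0) = \<chi> h * f 0"
    using assms \<open>h \<in> H\<close> unfolding chi_symmetric_def by blast
  ultimately show ?thesis by (auto simp: active_def supp_def)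
qed (simp add: active_def)

lemma symmetric_supp_closed: "chi_symmetric H \<chi> f \<Longrightarrow> closed (supp f)"
  by (auto simp: closed_def chi_symmetric_def supp_def chi_nonzero)

text \<open>Replacing \<open>a\<close> by \<open>h * a\<close> in the sum moves \<open>h\<close> to
  the index of the character. Thus the transform is symmetric for the inverse of
  \<open>\<chi>\<close>, and its support is constrained as that of \<open>f\<close> is.\<close>

lemma fourier_mult:
  assumes "chi_symmetric H \<chi> f" "h \<in> H"
  shows "\<chi> h * fourier f (eps (h * b)) = fourier f (eps b)"
proof -
  have "fourier f (eps b) = (\<Sum>a\<in>UNIV. f (h * a) * eps b (h * a))"
    unfolding fourier_def
    using nonzero[OF assms(2)]
    by (intro sum.reindex_bij_witness[of _ "\<lambda>a. h * a" "\<lambda>a. inverse h * a"])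
      (auto simp: mult.assoc[symmetric])
  also have "\<dots> = \<chi> h * fourier f (eps (h * b))"
    using assms unfolding fourier_def eps_def chi_symmetric_def sum_distrib_left
    by (intro sum.cong) (simp_all add: mult.assoc mult.left_commute[of b])
  finally show ?thesis by simp
qed

lemma symmetric_spectrum_active:
  assumes "chi_symmetric H \<chi> f"
  shows "spectrum f \<subseteq> active"
proof (cases "trivial_character H \<chi>")
  case False
  then obtain h where "h \<in> H" "\<chi> h \<noteq> 1" by (auto simp: trivial_character_def)
  then show ?thesis using fourier_mult[OF assms \<open>h \<in> H\<close>, of 0]
    by (auto simp: active_def spectrum_def)
qed (simp add: active_def)

lemma symmetric_spectrum_closed: "chi_symmetric H \<chi> f \<Longrightarrow> closed (spectrum f)"
  unfolding closed_def spectrum_def using fourier_mult chi_nonzero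
  by (metis (mono_tags, lifting) mem_Collect_eq mult_eq_0_iff)

section \<open>Symmetric functions on a single orbit\<close>

text \<open>Up to the factor \<open>card H\<close>, the projection of the point mass at
  \<open>a\<close> to the symmetric functions. The sum form also covers \<open>a = 0\<close>, whose
  stabiliser is all of \<open>H\<close>.\<close>

definition orbit_fun :: "'a \<Rightarrow> 'a \<Rightarrow> complex" where
  "orbit_fun a y = (\<Sum>h\<in>{h\<in>H. h * a = y}. \<chi> h)"

lemma orbit_fun_symmetric: "chi_symmetric H \<chi> (orbit_fun a)"
  unfolding chi_symmetric_def
proof (intro ballI allI)
  fix g y assume g: "g \<in> H"
  have "\<chi> g * orbit_fun a y = (\<Sum>h\<in>{h\<in>H. h * a = y}. \<chi> (g * h))"
    using g by (simp add: orbit_fun_def sum_distrib_left chi_mult)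
  also have "\<dots> = orbit_fun a (g * y)"
    unfolding orbit_fun_def using g nonzero[OF g]
    by (intro sum.reindex_bij_witness[of _ "\<lambda>h. inverse g * h" "\<lambda>h. g * h"])
      (auto simp: mult_mem inverse_mem mult.assoc)
  finally show "orbit_fun a (g * y) = \<chi> g * orbit_fun a y" by simp
qed

lemma orbit_fun_outside: "y \<notin> orbit H a \<Longrightarrow> orbit_fun a y = 0"
  unfolding orbit_fun_def by (rule sum.neutral) (auto simp: orbit_def)

text \<open>A nonzero point has trivial stabiliser, so only \<open>h = 1\<close> contributes. If
  \<open>0\<close> is active, \<open>\<chi>\<close> is trivial and the sum at \<open>0\<close> is
  \<open>card H\<close>.\<close>

lemma orbit_fun_self:
  assumes "a \<in> active"
  shows "orbit_fun a a \<noteq> 0"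
proof (cases "a = 0")
  case True
  with assms have "\<forall>h\<in>H. \<chi> h = 1"
    by (auto simp: active_def trivial_character_def split: if_splits)
  then show ?thesis using True one_mem by (auto simp: orbit_fun_def)
next
  case False
  then have "{h \<in> H. h * a = a} = {1}" using one_mem by auto
  then show ?thesis using chi_nonzero[OF one_mem] by (simp add: orbit_fun_def)
qed

section \<open>Orbit representatives\<close>

text \<open>The choice sees only the orbit as a set, so it is constant on each orbit.\<close>

definition rep :: "'a \<Rightarrow> 'a" where
  "rep y = (SOME z. z \<in> orbit H y)"

lemma rep_mem: "rep y \<in> orbit H y"
  unfolding rep_def using mem_orbit_self by (rule someI)

lemma rep_cong: "y \<in> orbit H z \<Longrightarrow> rep y = rep z"
  by (simp add: rep_def orbit_eq)

text \<open>One point from each orbit in \<open>active\<close>, so \<open>card reps\<close> is the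
  number \<open>N\<close>.\<close>

definition reps :: "'a set" where
  "reps = rep ` active"

lemma mem_active_orbit: "y \<in> orbit H z \<Longrightarrow> y \<in> active \<longleftrightarrow> z \<in> active"
  using nonzero by (auto simp: active_def orbit_def)

lemma rep_mem_reps: "y \<in> active \<Longrightarrow> rep y \<in> reps"
  by (simp add: reps_def)

lemma reps_active: "reps \<subseteq> active"
  using mem_active_orbit[OF rep_mem] by (auto simp: reps_def)

lemma rep_of_reps: "a \<in> reps \<Longrightarrow> rep a = a"
  using rep_cong[OF rep_mem] by (auto simp: reps_def)

lemma reps_same_orbit: "a \<in> reps \<Longrightarrow> b \<in> reps \<Longrightarrow> b \<in> orbit H a \<Longrightarrow> a = b"
  using rep_cong rep_of_reps by metis

lemma rep_mem_closed: "closed S \<Longrightarrow> rep y \<in> S \<longleftrightarrow> y \<in> S"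
  using rep_mem[of y] by (auto simp: closed_def orbit_def)

lemma closed_eqI:
  assumes "closed S" "closed T" "S \<subseteq> active" "T \<subseteq> active" "reps \<inter> S = reps \<inter> T"
  shows "S = T"
proof -
  have "y \<in> S \<longleftrightarrow> y \<in> T" if "y \<in> active" for y
    using rep_mem_closed[OF assms(1), of y] rep_mem_closed[OF assms(2), of y]
      rep_mem_reps[OF that] assms(5) by blast
  then show ?thesis using assms(3,4) by blast
qed

text \<open>Away from \<open>0\<close> the orbits are disjoint and all have \<open>card H\<close>
  points; \<open>0\<close> is split off because its orbit is a single point.\<close>

lemma card_closed:
  assumes "closed S"
  shows "card (S - {0}) = card H * card (reps \<inter> S - {0})"
proof -
  have eq: "S - {0} = (\<Union>a\<in>reps \<inter> S - {0}. orbit H a)" (is "_ = ?U")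
  proof
    show "?U \<subseteq> S - {0}" using assms nonzero by (auto simp: closed_iff orbit_def)
    show "S - {0} \<subseteq> ?U"
    proof
      fix y assume y: "y \<in> S - {0}"
      then have "y \<in> active" by (simp add: active_def)
      moreover have "rep y \<noteq> 0" using rep_mem[of y] y nonzero by (auto simp: orbit_def)
      moreover have "y \<in> orbit H (rep y)" using orbit_eq[OF rep_mem] mem_orbit_self by blast
      ultimately show "y \<in> ?U" using y rep_mem_reps rep_mem_closed[OF assms] by blast
    qed
  qed
  have "orbit H a \<inter> orbit H b = {}" if "a \<in> reps" "b \<in> reps" "a \<noteq> b" for a b
    using that reps_same_orbit[of a b] orbit_eq mem_orbit_self by blast
  then have "card ?U = (\<Sum>a\<in>reps \<inter> S - {0}. card (orbit H a))"
    by (intro card_UN_disjoint) auto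
  also have "\<dots> = (\<Sum>a\<in>reps \<inter> S - {0}. card H)"
    by (rule sum.cong) (auto simp: card_orbit)
  finally show ?thesis by (simp add: eq)
qed

lemma zero_mem_reps_iff: "0 \<in> reps \<longleftrightarrow> trivial_character H \<chi>"
proof -
  have "rep 0 = 0" using rep_mem[of 0] by (auto simp: orbit_def)
  then have "0 \<in> active \<Longrightarrow> 0 \<in> reps" using rep_mem_reps[of 0] by simp
  then show ?thesis using reps_active by (auto simp: active_def split: if_splits)
qed

section \<open>From cardinalities to orbit counts\<close>

text \<open>The same threshold serves as the lower bound of the uncertainty property, at
  \<open>supp f\<close> and \<open>spectrum f\<close>, and as the hypothesis on the prescribed
  sets.\<close>

definition bound :: "'a set \<Rightarrow> 'a set \<Rightarrow> nat" where
  "bound A B =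
     (if trivial_character H \<chi> then
        (if 0 \<notin> A \<and> 0 \<notin> B then CARD('a) + 2 * card H - 1
         else if 0 \<notin> A \<or> 0 \<notin> B then CARD('a) + card H
         else CARD('a) + 1)
      else CARD('a) + card H - 1)"

text \<open>With \<open>n\<close>, \<open>k\<close>, \<open>l\<close> counting nonzero
  representatives, the inequality reduces to \<open>n + c \<le> k + l\<close>. Here \<open>c\<close>
  is \<open>1\<close> for nontrivial \<open>\<chi>\<close>, and otherwise the number of sets among
  \<open>A\<close>, \<open>B\<close> that miss \<open>0\<close>.\<close>

lemma bound_le_iff:
  assumes "closed A" "closed B" "A \<subseteq> active" "B \<subseteq> active"
  shows "bound A B \<le> card A + card B \<longleftrightarrow> Suc (card reps) \<le> card (reps \<inter> A) + card (reps \<inter> B)"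
proof -
  have card_split: "card S = card (S - {0}) + (if 0 \<in> S then 1 else 0)" for S :: "'a set"
    using card_Suc_Diff1[of S 0] by simp
  define n where "n = card (reps - {0})"
  define k where "k = card (reps \<inter> A - {0})"
  define l where "l = card (reps \<inter> B - {0})"
  have cA: "card A = card H * k + (if 0 \<in> A then 1 else 0)"
    using card_split[of A] card_closed[OF assms(1)] by (simp add: k_def)
  have cB: "card B = card H * l + (if 0 \<in> B then 1 else 0)"
    using card_split[of B] card_closed[OF assms(2)] by (simp add: l_def)
  have cU: "CARD('a) = card H * n + 1"
    using card_split[of "UNIV :: 'a set"] card_closed[OF closed_UNIV] by (simp add: n_def)
  have rA: "card (reps \<inter> A) = k + (if 0 \<in> reps \<and> 0 \<in> A then 1 else 0)"
    using card_split[of "reps \<inter> A"] by (simp add: k_def)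
  have rB: "card (reps \<inter> B) = l + (if 0 \<in> reps \<and> 0 \<in> B then 1 else 0)"
    using card_split[of "reps \<inter> B"] by (simp add: l_def)
  have rU: "card reps = n + (if 0 \<in> reps then 1 else 0)"
    using card_split[of reps] by (simp add: n_def)
  have cancel: "card H * n + card H * c \<le> card H * k + card H * l \<longleftrightarrow> n + c \<le> k + l" for c
    using card_H_pos by (simp flip: distrib_left)
  show ?thesis
  proof (cases "trivial_character H \<chi>")
    case True
    then show ?thesis
      using zero_mem_reps_iff cancel[of 0] cancel[of 1] cancel[of 2]
      unfolding bound_def cA cB cU rA rB rU by auto
  next
    case False
    then have "0 \<notin> A" "0 \<notin> B" using assms by (auto simp: active_def)
    then show ?thesis
      using False zero_mem_reps_iff cancel[of 1]
      unfolding bound_def cA cB cU rA rB rU by auto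
  qed
qed

lemma uncertainty_orbits:
  assumes "strong_uncertainty H \<chi>" "chi_symmetric H \<chi> f" "f \<noteq> (\<lambda>_. 0)"
  shows "Suc (card reps) \<le> card (reps \<inter> supp f) + card (reps \<inter> spectrum f)"
proof -
  have "bound (supp f) (spectrum f) \<le> card (supp f) + card (fourier_supp f)"
    using assms(1)[unfolded strong_uncertainty_def, rule_format, of f] assms(2,3)
    by (auto simp: bound_def supp_def spectrum_def)
  \<comment> \<open>An image has at most as many elements, so the lower bound passes to
    \<open>spectrum f\<close>.\<close>
  also have "card (fourier_supp f) \<le> card (spectrum f)"
    by (simp add: fourier_supp_eq card_image_le)
  finally show ?thesis
    using bound_le_iff symmetric_supp_closed symmetric_spectrum_closed
      symmetric_supp_active symmetric_spectrum_active assms(2) by simp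
qed

section \<open>Functions with prescribed supports\<close>

lemma tight_supports:
  assumes su: "strong_uncertainty H \<chi>"
    and K: "K \<subseteq> reps" and L: "L \<subseteq> reps" and card: "card K + card L = Suc (card reps)"
  shows "\<exists>f. chi_symmetric H \<chi> f \<and> reps \<inter> supp f = K \<and> reps \<inter> spectrum f = L"
proof -
  have "card (reps - L) = card reps - card L" using L by (simp add: card_Diff_subset)
  moreover have "card L \<le> card reps" using L by (simp add: card_mono)
  \<comment> \<open>The unknowns are the coefficients of the orbit functions for \<open>K\<close>,
    the equations the vanishing of the transform on \<open>reps - L\<close>: exactly one equation
    fewer than unknowns.\<close>
  ultimately have "card (reps - L) < card K" using card by linarith
  then obtain x where x: "\<exists>a\<in>K. x a \<noteq> 0"
    "\<forall>b\<in>reps - L. (\<Sum>a\<in>K. fourier (orbit_fun a) (eps b) * x a) = 0"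
    using underdetermined_system[of "reps - L" K "\<lambda>b a. fourier (orbit_fun a) (eps b)"] by auto
  define f where "f = (\<lambda>y. \<Sum>a\<in>K. orbit_fun a y * x a)"
  have sym: "chi_symmetric H \<chi> f"
    using orbit_fun_symmetric by (simp add: chi_symmetric_def f_def sum_distrib_left mult.assoc)
  have "fourier f (eps b) = (\<Sum>a\<in>K. fourier (orbit_fun a) (eps b) * x a)" for b
    unfolding fourier_def f_def sum_distrib_right
    by (subst sum.swap) (simp add: mult_ac)
  then have specL: "reps \<inter> spectrum f \<subseteq> L"
    using x(2) by (auto simp: spectrum_def)
  \<comment> \<open>Distinct representatives lie in different orbits, so at most one orbit function
    survives at \<open>a\<close>. This bounds the support and shows \<open>f\<close> to be
    nonzero.\<close>
  have f_reps: "f a = (if a \<in> K then orbit_fun a a * x a else 0)" if "a \<in> reps" for a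
  proof -
    have "f a = (\<Sum>c\<in>K. if c = a then orbit_fun a a * x a else 0)"
      unfolding f_def
    proof (rule sum.cong)
      fix c assume "c \<in> K"
      then have "a \<notin> orbit H c" if "c \<noteq> a"
        using that reps_same_orbit[of c a] \<open>a \<in> reps\<close> K by blast
      then show "orbit_fun c a * x c = (if c = a then orbit_fun a a * x a else 0)"
        using orbit_fun_outside by auto
    qed simp
    then show ?thesis by simp
  qed
  then have suppK: "reps \<inter> supp f \<subseteq> K" by (auto simp: supp_def split: if_splits)
  obtain a where a: "a \<in> K" "x a \<noteq> 0" using x(1) by blast
  have "a \<in> reps" "a \<in> active" using a K reps_active by auto
  then have "f a \<noteq> 0" using a orbit_fun_self f_reps by simp
  then have "f \<noteq> (\<lambda>_. 0)" by auto
  from uncertainty_orbits[OF su sym this]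
  have le: "Suc (card reps) \<le> card (reps \<inter> supp f) + card (reps \<inter> spectrum f)" .
  \<comment> \<open>These upper bounds add up to the lower bound just obtained, so both inclusions
    are equalities.\<close>
  have "card (reps \<inter> supp f) \<le> card K" "card (reps \<inter> spectrum f) \<le> card L"
    using suppK specL by (auto intro: card_mono)
  with le card have "card (reps \<inter> supp f) = card K" "card (reps \<inter> spectrum f) = card L"
    by linarith+
  then have "reps \<inter> supp f = K" "reps \<inter> spectrum f = L"
    using card_subset_eq[OF _ suppK] card_subset_eq[OF _ specL] by simp_all
  with sym show ?thesis by blast
qed

lemma exists_prescribed_supports:
  assumes su: "strong_uncertainty H \<chi>"
    and A: "closed A" "A \<subseteq> active" and B: "closed B" "B \<subseteq> active"
    and bound: "bound A B \<le> card A + card B"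
  shows "\<exists>f. chi_symmetric H \<chi> f \<and> supp f = A \<and> fourier_supp f = eps ` B"
proof -
  let ?A = "reps \<inter> A" and ?B = "reps \<inter> B"
  have le: "Suc (card reps) \<le> card ?A + card ?B"
    using bound bound_le_iff A B by blast
  define V where
    "V = {f. chi_symmetric H \<chi> f \<and> reps \<inter> supp f \<subseteq> A \<and> reps \<inter> spectrum f \<subseteq> B}"
  \<comment> \<open>The values of \<open>f\<close> and of its transform form one function on a
    disjoint sum, so a single generic choice handles both supports.\<close>
  define vals where "vals = (\<lambda>f :: 'a \<Rightarrow> complex. case_sum f (\<lambda>b. fourier f (eps b)))"
  have V_comb: "(\<lambda>y. f y + t * g y) \<in> V" if "f \<in> V" "g \<in> V" for f g t
  proof -
    have "chi_symmetric H \<chi> (\<lambda>y. f y + t * g y)"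
      using that by (simp add: V_def chi_symmetric_def algebra_simps)
    moreover have "supp (\<lambda>y. f y + t * g y) \<subseteq> supp f \<union> supp g"
      by (auto simp: supp_def)
    moreover have "spectrum (\<lambda>y. f y + t * g y) \<subseteq> spectrum f \<union> spectrum g"
      by (auto simp: spectrum_def fourier_add_scaled)
    ultimately show ?thesis using that unfolding V_def by blast
  qed
  have vals_comb: "vals (\<lambda>y. f y + t * g y) = (\<lambda>s. vals f s + t * vals g s)" for f g t
    by (auto simp: vals_def fun_eq_iff fourier_add_scaled split: sum.split)
  have "\<exists>v\<in>vals ` V. \<forall>s\<in>?A <+> ?B. v s \<noteq> 0"
  proof (rule common_nonvanishing_element)
    have "(\<lambda>_. 0) \<in> V" by (simp add: V_def chi_symmetric_def supp_def spectrum_def fourier_def)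
    then show "vals ` V \<noteq> {}" by blast
    show "(\<lambda>s. v s + t * w s) \<in> vals ` V" if "v \<in> vals ` V" "w \<in> vals ` V" for v w t
      using that V_comb by (auto simp flip: vals_comb)
    show "\<exists>v\<in>vals ` V. v s \<noteq> 0" if s: "s \<in> ?A <+> ?B" for s
    proof -
      have "\<exists>K L. K \<subseteq> ?A \<and> L \<subseteq> ?B \<and> s \<in> K <+> L \<and> card K + card L = Suc (card reps)"
        using s
      proof (rule PlusE)
        fix a assume a: "a \<in> ?A" "s = Inl a"
        show ?thesis using subsets_with_card_sum[OF _ _ a(1) le] a(2) by auto
      next
        fix b assume b: "b \<in> ?B" "s = Inr b"
        \<comment> \<open>The two sets exchange roles, so that the chosen element is kept in
          \<open>L\<close>.\<close>
        have "Suc (card reps) \<le> card ?B + card ?A" using le by simp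
        from subsets_with_card_sum[OF _ _ b(1) this] b(2) show ?thesis
          by (metis InrI add.commute finite)
      qed
      then obtain K L where KL: "K \<subseteq> ?A" "L \<subseteq> ?B" "s \<in> K <+> L"
        "card K + card L = Suc (card reps)" by blast
      then obtain f where f: "chi_symmetric H \<chi> f" "reps \<inter> supp f = K" "reps \<inter> spectrum f = L"
        using tight_supports[OF su, of K L] by auto
      then have "f \<in> V" using KL by (auto simp: V_def)
      moreover have "vals f s \<noteq> 0"
        using KL(3) f(2,3) by (auto simp: vals_def supp_def spectrum_def)
      ultimately show ?thesis by blast
    qed
  qed simp
  then obtain f where f: "f \<in> V" "\<forall>s\<in>?A <+> ?B. vals f s \<noteq> 0" by blast
  then have "\<forall>a\<in>?A. f a \<noteq> 0" "\<forall>b\<in>?B. fourier f (eps b) \<noteq> 0"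
    by (force simp: vals_def)+
  then have eqs: "reps \<inter> supp f = ?A" "reps \<inter> spectrum f = ?B"
    using f(1) by (auto simp: V_def supp_def spectrum_def)
  have sym: "chi_symmetric H \<chi> f" using f(1) by (simp add: V_def)
  \<comment> \<open>Closed subsets of \<open>active\<close> are determined by their
    representatives.\<close>
  have "supp f = A"
    using closed_eqI[OF symmetric_supp_closed[OF sym] A(1) symmetric_supp_active[OF sym] A(2)] eqs
    by simp
  moreover have "spectrum f = B"
    using closed_eqI[OF symmetric_spectrum_closed[OF sym] B(1) symmetric_spectrum_active[OF sym] B(2)]
      eqs by simp
  ultimately show ?thesis using sym fourier_supp_eq by blast
qed

end

theorem theorem4p7:
  fixes H :: "'a :: finite_field set" and \<chi> :: "'a \<Rightarrow> complex"
  assumes "mult_subgroup H" and "mult_character H \<chi>" and "strong_uncertainty H \<chi>"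
  shows "(\<not> trivial_character H \<chi> \<longrightarrow>
            (\<forall>A B. A \<subseteq> UNIV - {0} \<and> B \<subseteq> UNIV - {0} \<and> H_closed H A \<and> H_closed H B \<and>
               card A + card B \<ge> CARD('a) + card H - 1 \<longrightarrow>
               (\<exists>f. chi_symmetric H \<chi> f \<and> supp f = A \<and> fourier_supp f = eps ` B))) \<and>
         (trivial_character H \<chi> \<longrightarrow>
            (\<forall>A B. H_closed H A \<and> H_closed H B \<and>
               card A + card B \<ge>
                 (if 0 \<notin> A \<and> 0 \<notin> B then CARD('a) + 2 * card H - 1
                  else if 0 \<notin> A \<or> 0 \<notin> B then CARD('a) + card H
                  else CARD('a) + 1) \<longrightarrow>
               (\<exists>f. chi_symmetric H \<chi> f \<and> supp f = A \<and> fourier_supp f = eps ` B)))"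
proof -
  interpret subgroup_character H \<chi> using assms by unfold_locales
  \<comment> \<open>For nontrivial \<open>\<chi>\<close>, lying in \<open>active\<close> means
    avoiding \<open>0\<close>; for trivial \<open>\<chi>\<close> it is no restriction.\<close>
  show ?thesis
    using exists_prescribed_supports[OF assms(3)] H_closed_imp_closed
    by (simp add: active_def bound_def)
qed

end
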